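(* Let $K$ be a field, $m\geq 2$, and let $\mathbf{a}: a_1>a_2>\cdots>a_m=0$ and $\mathbf{b}: 0=b_1<b_2<\cdots<b_m$ be integer sequences. Let $I\subset K[x,y]$ be the monomial ideal with minimal set of monomial generators $G(I)=\{u_1,\ldots,u_m\}$, where $u_i=x^{a_i}y^{b_i}$. Suppose that the sequences $\mathbf{a}$ and $\mathbf{b}$ are either both convex or both concave (in the sense defined in the context). Then for each $k=2,\ldots,2m$ the diagonal $$D_k=\{u_iu_j : 1\leq i\leq j\leq m,\ i+j=k\}$$ contains exactly one element of $G(I^2)$. In particular, $\mu(I^2)=2\mu(I)-1$. More precisely, $$G(I^2)=\{u_1^2,\ldots,u_m^2,\,u_1u_2,\,u_2u_3,\ldots,u_{m-1}u_m\}$$ if $\mathbf{a}$ and $\mathbf{b}$ are concave, and $$G(I^2)=\{u_1^2,\,u_1u_2,\ldots,u_1u_m,\,u_2u_m,\ldots,u_m^2\}$$ if $\mathbf{a}$ and $\mathbf{b}$ are convex.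
   Context: For a monomial ideal $L$, $G(L)$ denotes its unique minimal set of monomial generators and $\mu(L)=|G(L)|$. Convention of the paper: a sequence of integers $c_1,\ldots,c_m$ is called concave if $2c_i\leq c_{i-1}+c_{i+1}$ for $i=2,\ldots,m-1$, and convex if $2c_i\geq c_{i-1}+c_{i+1}$ for $i=2,\ldots,m-1$. The set $D_k$ is regarded as a set of monomials. *)

theory Defs
  imports Complex_Main "HOL-Library.Poly_Mapping" "HOL-Library.Product_Plus"
begin

text \<open>
  The polynomial ring K[x,y] is the monoid algebra of \<^typ>\<open>nat \<times> nat\<close> over a field: the exponent
  vector \<open>(p, q)\<close> stands for x^p y^q, and multiplication is convolution over the componentwise
  addition of exponents.
\<close>

type_synonym 'k poly2 = "(nat \<times> nat) \<Rightarrow>\<^sub>0 'k"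

text \<open>
  Ideals of a commutative ring are its submodules: \<open>ideal.subspace I\<close> says that \<open>I\<close> is an ideal and
  \<open>ideal.span S\<close> is the ideal generated by \<open>S\<close>.
\<close>

interpretation ideal: module "(*) :: 'a::comm_ring_1 \<Rightarrow> 'a \<Rightarrow> 'a"
  by standard (simp_all add: algebra_simps)

definition ideal_mult :: "'a::comm_ring_1 set \<Rightarrow> 'a set \<Rightarrow> 'a set"
  where "ideal_mult I J = ideal.span {f * g | f g. f \<in> I \<and> g \<in> J}"

definition mon :: "nat \<Rightarrow> nat \<Rightarrow> 'k::field poly2"
  where "mon p q = Poly_Mapping.single (p, q) 1"

definition monomials :: "'k::field poly2 set"
  where "monomials = {mon p q | p q. True}"

definition monomial_ideal :: "'k::field poly2 set \<Rightarrow> bool"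
  where "monomial_ideal L \<longleftrightarrow> (\<exists>S\<subseteq>monomials. L = ideal.span S)"

definition is_min_mon_gens :: "'k::field poly2 set \<Rightarrow> 'k poly2 set \<Rightarrow> bool"
  where "is_min_mon_gens L S \<longleftrightarrow>
    S \<subseteq> monomials \<and> ideal.span S = L \<and> (\<forall>T. T \<subset> S \<longrightarrow> ideal.span T \<noteq> L)"

text \<open>
  Meaningful for monomial ideals only; existence and uniqueness of the set described here are
  established in \<open>ex1_min_mon_gens\<close> below.
\<close>

definition min_gens :: "'k::field poly2 set \<Rightarrow> 'k poly2 set"
  where "min_gens L = (THE S. is_min_mon_gens L S)"

definition mu :: "'k::field poly2 set \<Rightarrow> nat"
  where "mu L = card (min_gens L)"

text \<open>
  The next two notions follow a convention that is opposite to the usual one for functions.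
  Sequences are indexed from 1.
\<close>

definition concave_seq :: "nat \<Rightarrow> (nat \<Rightarrow> int) \<Rightarrow> bool"
  where "concave_seq m c \<longleftrightarrow> (\<forall>i\<in>{2..m - 1}. 2 * c i \<le> c (i - 1) + c (i + 1))"

definition convex_seq :: "nat \<Rightarrow> (nat \<Rightarrow> int) \<Rightarrow> bool"
  where "convex_seq m c \<longleftrightarrow> (\<forall>i\<in>{2..m - 1}. 2 * c i \<ge> c (i - 1) + c (i + 1))"

definition diagonal :: "(nat \<Rightarrow> 'k::field poly2) \<Rightarrow> nat \<Rightarrow> nat \<Rightarrow> 'k poly2 set"
  where "diagonal u m k = {u i * u j | i j. 1 \<le> i \<and> i \<le> j \<and> j \<le> m \<and> i + j = k}"

lemma mon_mult: "mon p q * mon r s = mon (p + r) (q + s)"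
  by (simp add: mon_def mult_single)

lemma mon_eq_iff: "(mon p q :: 'k::field poly2) = mon r s \<longleftrightarrow> p = r \<and> q = s"
proof
  assume "(mon p q :: 'k poly2) = mon r s"
  hence "Poly_Mapping.keys (mon p q :: 'k poly2) = Poly_Mapping.keys (mon r s :: 'k poly2)"
    by simp
  thus "p = r \<and> q = s" by (simp add: mon_def)
qed simp

lemma keys_ideal_span:
  fixes f :: "'k::field poly2"
  assumes "f \<in> ideal.span S" "S \<subseteq> monomials" "(p, q) \<in> Poly_Mapping.keys f"
  shows "\<exists>r s. mon r s \<in> S \<and> r \<le> p \<and> s \<le> q"
  using assms(1,3)
proof (induction arbitrary: p q rule: ideal.span_induct_alt)
  case base
  thus ?case by simp
next
  case (step c x y)
  obtain r s where x: "x = mon r s" using step.hyps assms(2) by (auto simp: monomials_def)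
  consider "(p, q) \<in> Poly_Mapping.keys (c * x)" | "(p, q) \<in> Poly_Mapping.keys y"
    using step.prems keys_add[of "c * x" y] by blast
  thus ?case
  proof cases
    case 1
    hence "(p, q) \<in> {a + b | a b. a \<in> Poly_Mapping.keys c \<and> b \<in> Poly_Mapping.keys x}"
      using keys_mult[of c x] by blast
    thus ?thesis using step.hyps by (force simp: x mon_def)
  next
    case 2
    thus ?thesis by (rule step.IH)
  qed
qed

lemma mon_in_span_iff:
  fixes S :: "'k::field poly2 set"
  assumes "S \<subseteq> monomials"
  shows "mon p q \<in> ideal.span S \<longleftrightarrow> (\<exists>r s. mon r s \<in> S \<and> r \<le> p \<and> s \<le> q)"
proof
  assume "mon p q \<in> ideal.span S"
  thus "\<exists>r s. mon r s \<in> S \<and> r \<le> p \<and> s \<le> q"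
    by (rule keys_ideal_span[OF _ assms]) (simp add: mon_def)
next
  assume "\<exists>r s. mon r s \<in> S \<and> r \<le> p \<and> s \<le> q"
  then obtain r s where rs: "mon r s \<in> S" "r \<le> p" "s \<le> q" by blast
  have "mon (p - r) (q - s) * mon r s \<in> ideal.span S"
    by (rule ideal.span_scale[OF ideal.span_base[OF rs(1)]])
  thus "mon p q \<in> ideal.span S" using rs by (simp add: mon_mult)
qed

lemma is_min_mon_gens_iff:
  fixes L :: "'k::field poly2 set"
  assumes "monomial_ideal L"
  shows "is_min_mon_gens L S \<longleftrightarrow>
    S = {mon p q | p q. mon p q \<in> L \<and> (\<forall>r s. mon r s \<in> L \<and> r \<le> p \<and> s \<le> q \<longrightarrow> r = p \<and> s = q)}"
    (is "_ \<longleftrightarrow> S = ?M")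
proof -
  obtain B where B: "B \<subseteq> monomials" "L = ideal.span B"
    using assms by (auto simp: monomial_ideal_def)
  have sub: "?M \<subseteq> T" if T: "T \<subseteq> monomials" "ideal.span T = L" for T
    using mon_in_span_iff[OF T(1)] T(2) by blast
  have ex: "\<exists>r s. mon r s \<in> ?M \<and> r \<le> p \<and> s \<le> q" if "mon p q \<in> L" for p q
    using that
  proof (induction "p + q" arbitrary: p q rule: less_induct)
    case less
    show ?case
    proof (cases "mon p q \<in> ?M")
      case False
      then obtain r s where rs: "mon r s \<in> L" "r \<le> p" "s \<le> q" and ne: "r \<noteq> p \<or> s \<noteq> q"
        using less.prems by blast
      have lt: "r + s < p + q" using rs(2,3) ne by linarith
      obtain r' s' where "mon r' s' \<in> ?M" "r' \<le> r" "s' \<le> s"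
        using less.hyps[OF lt rs(1)] by blast
      thus ?thesis using rs(2,3) le_trans by blast
    qed blast
  qed
  have M: "?M \<subseteq> monomials" by (auto simp: monomials_def)
  have "B \<subseteq> ideal.span ?M"
  proof
    fix x assume x: "x \<in> B"
    then obtain p q where pq: "x = mon p q" using B(1) by (auto simp: monomials_def)
    have "mon p q \<in> L" using x pq B(2) by (simp add: ideal.span_base)
    thus "x \<in> ideal.span ?M" unfolding pq mon_in_span_iff[OF M] by (rule ex)
  qed
  hence "L \<subseteq> ideal.span ?M"
    unfolding B(2) by (rule ideal.span_minimal) (rule ideal.subspace_span)
  moreover have "ideal.span ?M \<subseteq> L"
    by (rule ideal.span_minimal) (auto simp: B(2))
  ultimately have span: "ideal.span ?M = L" by simp
  show ?thesis
  proof
    assume S: "is_min_mon_gens L S"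
    hence "?M \<subseteq> S" by (intro sub) (simp_all add: is_min_mon_gens_def)
    moreover have "\<not> ?M \<subset> S" using S span unfolding is_min_mon_gens_def by blast
    ultimately show "S = ?M" by (simp add: psubset_eq)
  next
    assume S: "S = ?M"
    have "ideal.span T \<noteq> L" if "T \<subset> ?M" for T
    proof
      assume "ideal.span T = L"
      moreover have "T \<subseteq> monomials" using that M by (meson order.trans psubset_imp_subset)
      ultimately have "?M \<subseteq> T" by (intro sub)
      thus False using that by (simp add: less_le_not_le)
    qed
    thus "is_min_mon_gens L S" unfolding is_min_mon_gens_def S using M span by simp
  qed
qed

lemma ex1_min_mon_gens: "monomial_ideal L \<Longrightarrow> \<exists>!S. is_min_mon_gens L S"
  by (simp add: is_min_mon_gens_iff)

end

theory Submission
  imports Defs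
begin

text \<open>
  The ideal \<open>I\<^sup>2\<close> is generated by the products \<open>u\<^sub>i u\<^sub>j\<close>, which the diagonals sort by \<open>k = i + j\<close>. A
  concave sequence satisfies \<open>c\<^sub>i\<^sub>+\<^sub>d + c\<^sub>j \<le> c\<^sub>i + c\<^sub>j\<^sub>+\<^sub>d\<close> for \<open>i \<le> j\<close> (lemma \<open>concave_seq_exchange\<close>):
  moving two indices towards each other, with fixed sum, never raises the value. So if both exponent
  sequences are concave, the innermost product on each diagonal divides all the others there; if both
  are convex, the outermost one does. In either case each diagonal contains one product whose
  \<open>x\<close>-exponent and \<open>y\<close>-exponent are minimal at the same time, and these products generate \<open>I\<^sup>2\<close>.

  None of them is redundant, whatever the reason for which the minima exist: the smallest value of
  \<open>a\<^sub>i + a\<^sub>j\<close> on a diagonal strictly decreases with \<open>k\<close>, since some index of the minimal pair can be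
  raised, and the smallest value of \<open>b\<^sub>i + b\<^sub>j\<close> strictly increases, since some index can be lowered.
  Hence the \<open>2m - 1\<close> minimal products are pairwise incomparable under divisibility. Lemma
  \<open>min_gens_square_if_diagonal_minima\<close> carries out this argument for an arbitrary choice of minima;
  \<open>concave_seq_innermost\<close> and \<open>convex_seq_outermost\<close> supply the two choices.
\<close>

section \<open>Generators of monomial ideals and of their products\<close>

lemma ideal_mult_span:
  fixes S T :: "'a::comm_ring_1 set"
  shows "ideal_mult (ideal.span S) (ideal.span T) = ideal.span {f * g | f g. f \<in> S \<and> g \<in> T}"
    (is "_ = ideal.span ?P")
proof -
  have base: "f * g \<in> ideal.span ?P" if f: "f \<in> S" and g: "g \<in> ideal.span T" for f g
    using g
  proof (induction rule: ideal.span_induct_alt)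
    case base
    show ?case by (simp add: ideal.span_zero)
  next
    case (step c x y)
    have "c * (f * x) \<in> ideal.span ?P"
      using f step.hyps by (intro ideal.span_scale ideal.span_base) auto
    from ideal.span_add[OF this step.IH] have "c * (f * x) + f * y \<in> ideal.span ?P" .
    moreover have "f * (c * x + y) = c * (f * x) + f * y" by (simp only: distrib_left mult.left_commute)
    ultimately show ?case by (simp only:)
  qed
  have prod: "f * g \<in> ideal.span ?P" if f: "f \<in> ideal.span S" and g: "g \<in> ideal.span T" for f g
    using f
  proof (induction rule: ideal.span_induct_alt)
    case base
    show ?case by (simp add: ideal.span_zero)
  next
    case (step c x y)
    have "c * (x * g) \<in> ideal.span ?P"
      using base[OF step.hyps(1) g] by (rule ideal.span_scale)
    from ideal.span_add[OF this step.IH] have "c * (x * g) + y * g \<in> ideal.span ?P" .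
    moreover have "(c * x + y) * g = c * (x * g) + y * g" by (simp only: distrib_right mult.assoc)
    ultimately show ?case by (simp only:)
  qed
  have "ideal_mult (ideal.span S) (ideal.span T) \<subseteq> ideal.span ?P"
    unfolding ideal_mult_def
    by (rule ideal.span_minimal) (use prod in auto)
  moreover have "ideal.span ?P \<subseteq> ideal_mult (ideal.span S) (ideal.span T)"
    unfolding ideal_mult_def
    by (rule ideal.span_mono) (blast intro: ideal.span_base)
  ultimately show ?thesis by (rule antisym)
qed

lemma span_min_gens: "monomial_ideal L \<Longrightarrow> ideal.span (min_gens L) = L"
  using theI'[OF ex1_min_mon_gens] by (auto simp: min_gens_def is_min_mon_gens_def)

text \<open>
  Divisibility of monomials decides membership in a monomial ideal, so covering every generator by a
  divisor gives generation, and incomparability gives irredundancy.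
\<close>

lemma min_gens_span_eqI:
  fixes S C :: "'k::field poly2 set"
  assumes S: "S \<subseteq> monomials" and C: "C \<subseteq> S"
    and cover: "\<And>p q. mon p q \<in> S \<Longrightarrow> \<exists>r s. mon r s \<in> C \<and> r \<le> p \<and> s \<le> q"
    and antichain: "\<And>p q r s. mon p q \<in> C \<Longrightarrow> mon r s \<in> C \<Longrightarrow> r \<le> p \<Longrightarrow> s \<le> q \<Longrightarrow> r = p \<and> s = q"
  shows "min_gens (ideal.span S) = C"
proof -
  have mC: "C \<subseteq> monomials" using S C by blast
  have "S \<subseteq> ideal.span C"
  proof
    fix x assume x: "x \<in> S"
    then obtain p q where "x = mon p q" using S by (auto simp: monomials_def)
    with x cover show "x \<in> ideal.span C" by (simp add: mon_in_span_iff[OF mC])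
  qed
  hence "ideal.span S \<subseteq> ideal.span C"
    by (rule ideal.span_minimal) (rule ideal.subspace_span)
  with ideal.span_mono[OF C] have span: "ideal.span C = ideal.span S" by (simp add: antisym)
  have "ideal.span T \<noteq> ideal.span S" if T: "T \<subset> C" for T
  proof
    assume eq: "ideal.span T = ideal.span S"
    obtain x where x: "x \<in> C" "x \<notin> T" using T by blast
    then obtain p q where pq: "x = mon p q" using mC by (auto simp: monomials_def)
    have mT: "T \<subseteq> monomials" using T mC by blast
    have "x \<in> ideal.span T"
      unfolding eq using x(1) C by (blast intro: ideal.span_base)
    then obtain r s where rs: "mon r s \<in> T" "r \<le> p" "s \<le> q"
      unfolding pq mon_in_span_iff[OF mT] by blast
    have "r = p \<and> s = q"
      using antichain[of p q r s] rs x(1) pq T by blast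
    with rs(1) x(2) pq show False by simp
  qed
  hence "is_min_mon_gens (ideal.span S) C"
    unfolding is_min_mon_gens_def using mC span by blast
  moreover have "monomial_ideal (ideal.span S)"
    using S by (auto simp: monomial_ideal_def)
  ultimately show ?thesis
    unfolding min_gens_def by (intro the1_equality ex1_min_mon_gens)
qed

section \<open>Squares whose diagonals have minima\<close>

text \<open>
  A pair minimising \<open>p i + p j\<close> on diagonal \<open>k\<close> can be raised to a pair on the later diagonal \<open>l\<close>,
  where the value is smaller and in turn bounds the minimum there. The lemma for increasing sequences
  is the mirror image: it lowers the minimal pair of the later diagonal.
\<close>

lemma diagonal_minima_less_if_antimono:
  fixes p :: "nat \<Rightarrow> nat"
  assumes anti: "strict_antimono_on {1..m} p"
    and sel: "\<And>k. k \<in> {2..2 * m} \<Longrightarrow> s k \<in> {1..m} \<and> t k \<in> {1..m} \<and> s k + t k = k"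
    and min: "\<And>i j. i \<in> {1..m} \<Longrightarrow> j \<in> {1..m} \<Longrightarrow> p (s (i + j)) + p (t (i + j)) \<le> p i + p j"
    and k: "2 \<le> k" and kl: "k < l" and l: "l \<le> 2 * m"
  shows "p (s l) + p (t l) < p (s k) + p (t k)"
proof -
  have st: "s k \<in> {1..m}" "t k \<in> {1..m}" "s k + t k = k"
    using sel[of k] k kl l by auto
  \<comment> \<open>The first index absorbs as much of the shift \<open>l - k\<close> as the bound \<open>m\<close> allows, the second the rest.\<close>
  define i where "i = min m (s k + (l - k))"
  define j where "j = l - i"
  have ij: "i \<in> {1..m}" "j \<in> {1..m}" "i + j = l" "s k \<le> i" "t k \<le> j" "s k < i \<or> t k < j"
    using st kl l by (auto simp: i_def j_def)
  have le: "p y \<le> p x" if "x \<le> y" "x \<in> {1..m}" "y \<in> {1..m}" for x y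
    using that monotone_onD[OF anti, of x y] by (cases "x = y") auto
  have lt: "p y < p x" if "x < y" "x \<in> {1..m}" "y \<in> {1..m}" for x y
    using that monotone_onD[OF anti, of x y] by auto
  have "p i + p j < p (s k) + p (t k)"
    using ij(6) le[OF ij(4) st(1) ij(1)] le[OF ij(5) st(2) ij(2)]
      lt[OF _ st(1) ij(1)] lt[OF _ st(2) ij(2)] by linarith
  with min[OF ij(1,2)] ij(3) show ?thesis by simp
qed

lemma diagonal_minima_less_if_mono:
  fixes q :: "nat \<Rightarrow> nat"
  assumes mono: "strict_mono_on {1..m} q"
    and sel: "\<And>k. k \<in> {2..2 * m} \<Longrightarrow> s k \<in> {1..m} \<and> t k \<in> {1..m} \<and> s k + t k = k"
    and min: "\<And>i j. i \<in> {1..m} \<Longrightarrow> j \<in> {1..m} \<Longrightarrow> q (s (i + j)) + q (t (i + j)) \<le> q i + q j"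
    and k: "2 \<le> k" and kl: "k < l" and l: "l \<le> 2 * m"
  shows "q (s k) + q (t k) < q (s l) + q (t l)"
proof -
  have st: "s l \<in> {1..m}" "t l \<in> {1..m}" "s l + t l = l"
    using sel[of l] k kl l by auto
  define i where "i = max 1 (s l - (l - k))"
  define j where "j = k - i"
  have ij: "i \<in> {1..m}" "j \<in> {1..m}" "i + j = k" "i \<le> s l" "j \<le> t l" "i < s l \<or> j < t l"
    using st kl k by (auto simp: i_def j_def)
  have le: "q x \<le> q y" if "x \<le> y" "x \<in> {1..m}" "y \<in> {1..m}" for x y
    using that monotone_onD[OF mono, of x y] by (cases "x = y") auto
  have lt: "q x < q y" if "x < y" "x \<in> {1..m}" "y \<in> {1..m}" for x y
    using that monotone_onD[OF mono, of x y] by auto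
  have "q i + q j < q (s l) + q (t l)"
    using ij(6) le[OF ij(4) ij(1) st(1)] le[OF ij(5) ij(2) st(2)]
      lt[OF _ ij(1) st(1)] lt[OF _ ij(2) st(2)] by linarith
  with min[OF ij(1,2)] ij(3) show ?thesis by simp
qed

text \<open>
  Here \<open>s k\<close> and \<open>t k\<close> are the indices of a product on diagonal \<open>k\<close> that divides all the others there.
  The opposite monotonicity of the two exponents along these products makes them incomparable, and it
  also prevents the minimal product of one diagonal from lying on another.
\<close>

lemma min_gens_square_if_diagonal_minima:
  fixes p q s t :: "nat \<Rightarrow> nat" and u :: "nat \<Rightarrow> 'k::field poly2"
  assumes u: "\<And>i. i \<in> {1..m} \<Longrightarrow> u i = mon (p i) (q i)"
    and p: "strict_antimono_on {1..m} p" and q: "strict_mono_on {1..m} q"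
    and sel: "\<And>k. k \<in> {2..2 * m} \<Longrightarrow> 1 \<le> s k \<and> s k \<le> t k \<and> t k \<le> m \<and> s k + t k = k"
    and min_p: "\<And>i j. i \<in> {1..m} \<Longrightarrow> j \<in> {1..m} \<Longrightarrow> p (s (i + j)) + p (t (i + j)) \<le> p i + p j"
    and min_q: "\<And>i j. i \<in> {1..m} \<Longrightarrow> j \<in> {1..m} \<Longrightarrow> q (s (i + j)) + q (t (i + j)) \<le> q i + q j"
  defines "L \<equiv> ideal.span (u ` {1..m})"
  shows "min_gens (ideal_mult L L) = (\<lambda>k. u (s k) * u (t k)) ` {2..2 * m}" (is "_ = ?v ` ?D")
    and "mu (ideal_mult L L) = 2 * m - 1"
    and "\<And>k. k \<in> {2..2 * m} \<Longrightarrow> \<exists>!v. v \<in> diagonal u m k \<and> v \<in> min_gens (ideal_mult L L)"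
proof -
  define P where "P k = p (s k) + p (t k)" for k
  define Q where "Q k = q (s k) + q (t k)" for k
  have sel': "s k \<in> {1..m} \<and> t k \<in> {1..m} \<and> s k + t k = k" if "k \<in> ?D" for k
    using sel[OF that] by auto
  have P_less: "P l < P k" if "2 \<le> k" "k < l" "l \<le> 2 * m" for k l
    unfolding P_def using p sel' min_p that by (rule diagonal_minima_less_if_antimono)
  have Q_less: "Q k < Q l" if "2 \<le> k" "k < l" "l \<le> 2 * m" for k l
    unfolding Q_def using q sel' min_q that by (rule diagonal_minima_less_if_mono)
  have incomparable: "k = l" if "k \<in> ?D" "l \<in> ?D" "P k \<le> P l" "Q k \<le> Q l" for k l
    using that P_less[of k l] Q_less[of l k] by (cases k l rule: linorder_cases) auto
  have v: "?v k = mon (P k) (Q k)" if "k \<in> ?D" for k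
    using sel'[OF that] by (simp add: u mon_mult P_def Q_def)
  define S where "S = {f * g | f g. f \<in> u ` {1..m} \<and> g \<in> u ` {1..m}}"
  have S_mon: "\<exists>i j. i \<in> {1..m} \<and> j \<in> {1..m} \<and> x = mon (p i + p j) (q i + q j)"
    if x: "x \<in> S" for x
  proof -
    from x obtain i j where ij: "i \<in> {1..m}" "j \<in> {1..m}" "x = u i * u j"
      unfolding S_def by blast
    thus ?thesis using u by (auto simp: mon_mult)
  qed
  have square: "ideal_mult L L = ideal.span S"
    unfolding L_def S_def by (rule ideal_mult_span)
  show gens: "min_gens (ideal_mult L L) = ?v ` ?D"
    unfolding square
  proof (rule min_gens_span_eqI)
    show "S \<subseteq> monomials" using S_mon unfolding monomials_def by blast
    show "?v ` ?D \<subseteq> S"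
    proof (rule image_subsetI)
      fix k assume "k \<in> ?D"
      from sel'[OF this] have "u (s k) \<in> u ` {1..m}" "u (t k) \<in> u ` {1..m}" by simp_all
      thus "?v k \<in> S" unfolding S_def by blast
    qed
  next
    fix x y assume "mon x y \<in> S"
    from S_mon[OF this] obtain i j where
      ij: "i \<in> {1..m}" "j \<in> {1..m}" and xy: "x = p i + p j" "y = q i + q j"
      by (auto simp: mon_eq_iff)
    have k: "i + j \<in> ?D" using ij by auto
    have "mon (P (i + j)) (Q (i + j)) \<in> ?v ` ?D"
      unfolding v[OF k, symmetric] using k by (rule imageI)
    moreover have "P (i + j) \<le> x" "Q (i + j) \<le> y"
      using min_p[OF ij] min_q[OF ij] by (simp_all add: P_def Q_def xy)
    ultimately show "\<exists>r s. mon r s \<in> ?v ` ?D \<and> r \<le> x \<and> s \<le> y" by blast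
  next
    fix x y z w
    assume "mon x y \<in> ?v ` ?D" "mon z w \<in> ?v ` ?D" and le: "z \<le> x" "w \<le> y"
    then obtain k l where k: "k \<in> ?D" "mon x y = ?v k" and l: "l \<in> ?D" "mon z w = ?v l"
      by blast
    hence xy: "x = P k" "y = Q k" and zw: "z = P l" "w = Q l"
      using v by (simp_all add: mon_eq_iff)
    from le have "l = k" unfolding xy zw by (rule incomparable[OF l(1) k(1)])
    thus "z = x \<and> w = y" by (simp add: xy zw)
  qed
  have "inj_on ?v ?D"
  proof (rule inj_onI)
    fix k l assume kl: "k \<in> ?D" "l \<in> ?D" and eq: "?v k = ?v l"
    show "k = l"
      using eq unfolding v[OF kl(1)] v[OF kl(2)] mon_eq_iff by (intro incomparable kl) auto
  qed
  thus "mu (ideal_mult L L) = 2 * m - 1"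
    unfolding mu_def gens by (simp add: card_image)
  fix k assume k: "k \<in> ?D"
  show "\<exists>!w. w \<in> diagonal u m k \<and> w \<in> min_gens (ideal_mult L L)"
    unfolding gens
  proof (rule ex1I[of _ "?v k"])
    have "?v k \<in> diagonal u m k"
      unfolding diagonal_def mem_Collect_eq using sel[OF k] by (intro exI conjI) auto
    thus "?v k \<in> diagonal u m k \<and> ?v k \<in> ?v ` ?D"
      using imageI[OF k, of ?v] by (rule conjI)
  next
    fix w assume w: "w \<in> diagonal u m k \<and> w \<in> ?v ` ?D"
    from w obtain i j where "1 \<le> i" "i \<le> j" "j \<le> m" and k_eq: "i + j = k" and "w = u i * u j"
      by (auto simp: diagonal_def)
    hence ij: "i \<in> {1..m}" "j \<in> {1..m}" and w1: "w = mon (p i + p j) (q i + q j)"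
      by (auto simp: u mon_mult)
    from w obtain l where l: "l \<in> ?D" and w2: "w = ?v l" by blast
    have "P l = p i + p j" "Q l = q i + q j"
      using w1 w2 unfolding v[OF l] by (simp_all add: mon_eq_iff)
    hence "P k \<le> P l" "Q k \<le> Q l"
      using min_p[OF ij] min_q[OF ij] unfolding k_eq by (simp_all add: P_def Q_def)
    hence "k = l" by (intro incomparable k l)
    thus "w = ?v k" using w2 by simp
  qed
qed

section \<open>Concave and convex sequences along a diagonal\<close>

lemma concave_seq_increments_mono:
  assumes c: "concave_seq m c" and ij: "1 \<le> i" "i \<le> j" "j < m"
  shows "c (Suc i) - c i \<le> c (Suc j) - c j"
  using ij(2,3)
proof (induction j rule: dec_induct)
  case (step n)
  have "Suc n \<in> {2..m - 1}" using step ij(1) by auto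
  with c have "2 * c (Suc n) \<le> c n + c (Suc (Suc n))"
    unfolding concave_seq_def by fastforce
  with step show ?case by linarith
qed simp

text \<open>
  Both sides add an increment of \<open>c\<close> over a window of length \<open>d\<close> to \<open>c i + c j\<close>, and the window on the
  right starts later.
\<close>

lemma concave_seq_exchange:
  assumes c: "concave_seq m c" and ij: "1 \<le> i" "i \<le> j" "j + d \<le> m"
  shows "c (i + d) + c j \<le> c i + c (j + d)"
  using ij(3)
proof (induction d)
  case (Suc d)
  have "c (Suc (i + d)) - c (i + d) \<le> c (Suc (j + d)) - c (j + d)"
    using Suc.prems ij by (intro concave_seq_increments_mono[OF c]) auto
  with Suc show ?case by simp
qed simp

lemma convex_seq_exchange:
  assumes c: "convex_seq m c" and ij: "1 \<le> i" "i \<le> j" "j + d \<le> m"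
  shows "c i + c (j + d) \<le> c (i + d) + c j"
proof -
  have "concave_seq m (\<lambda>i. - c i)"
    using c by (force simp: convex_seq_def concave_seq_def)
  from concave_seq_exchange[OF this ij] show ?thesis by simp
qed

lemma concave_seq_innermost:
  assumes c: "concave_seq m c" and ij: "i \<in> {1..m}" "j \<in> {1..m}"
  shows "c ((i + j) div 2) + c (Suc (i + j) div 2) \<le> c i + c j"
proof -
  have *: "c ((i + j) div 2) + c (Suc (i + j) div 2) \<le> c i + c j"
    if le: "i \<le> j" and ij: "i \<in> {1..m}" "j \<in> {1..m}" for i j
  proof -
    define d where "d = (i + j) div 2 - i"
    have "i + d = (i + j) div 2" "Suc (i + j) div 2 + d = j"
      using le by (auto simp: d_def)
    moreover have "c (i + d) + c (Suc (i + j) div 2) \<le> c i + c (Suc (i + j) div 2 + d)"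
      using le ij calculation by (intro concave_seq_exchange[OF c]) auto
    ultimately show ?thesis by simp
  qed
  show ?thesis
    using *[of i j] *[of j i] ij by (cases "i \<le> j") (simp_all add: add.commute)
qed

text \<open>
  The truncated difference makes one formula cover both halves of the square: the outermost pair on
  diagonal \<open>k\<close> is \<open>(1, k - 1)\<close> for \<open>k \<le> m + 1\<close> and \<open>(k - m, m)\<close> afterwards.
\<close>

lemma convex_seq_outermost:
  assumes c: "convex_seq m c" and ij: "i \<in> {1..m}" "j \<in> {1..m}"
  shows "c (max 1 (i + j - m)) + c (min m (i + j - 1)) \<le> c i + c j"
proof (cases "i + j \<le> m + 1")
  case True
  have "c 1 + c (j + (i - 1)) \<le> c (1 + (i - 1)) + c j"
    using True ij by (intro convex_seq_exchange[OF c]) auto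
  moreover have "max 1 (i + j - m) = 1" "min m (i + j - 1) = j + (i - 1)" "1 + (i - 1) = i"
    using True ij by auto
  ultimately show ?thesis by simp
next
  case False
  have "c (i + j - m) + c (j + (m - j)) \<le> c (i + j - m + (m - j)) + c j"
    using False ij by (intro convex_seq_exchange[OF c]) auto
  moreover have "max 1 (i + j - m) = i + j - m" "min m (i + j - 1) = m"
    "j + (m - j) = m" "i + j - m + (m - j) = i"
    using False ij by auto
  ultimately show ?thesis by simp
qed

section \<open>The square of an ideal with concave or convex exponents\<close>

lemma innermost_products:
  fixes u :: "nat \<Rightarrow> 'a::monoid_mult"
  shows "(\<lambda>k. u (k div 2) * u (Suc k div 2)) ` {2..2 * m} =
    {u i ^ 2 | i. i \<in> {1..m}} \<union> {u i * u (i + 1) | i. i \<in> {1..m - 1}}" (is "?v ` _ = ?A \<union> ?B")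
proof (intro equalityI subsetI)
  fix x assume "x \<in> ?v ` {2..2 * m}"
  then obtain k where k: "2 \<le> k" "k \<le> 2 * m" "x = ?v k" by auto
  show "x \<in> ?A \<union> ?B"
  proof (cases "even k")
    case True
    then obtain i where i: "k = 2 * i" by (elim evenE)
    hence "x = u i ^ 2" "i \<in> {1..m}" using k by (auto simp: power2_eq_square)
    thus ?thesis by blast
  next
    case False
    then obtain i where i: "k = 2 * i + 1" by (elim oddE)
    hence "x = u i * u (i + 1)" "i \<in> {1..m - 1}" using k by auto
    thus ?thesis by blast
  qed
next
  fix x assume "x \<in> ?A \<union> ?B"
  then consider i where "i \<in> {1..m}" "x = u i ^ 2" | i where "i \<in> {1..m - 1}" "x = u i * u (i + 1)"
    by blast
  thus "x \<in> ?v ` {2..2 * m}"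
  proof cases
    case 1
    thus ?thesis by (intro image_eqI[of _ _ "2 * i"]) (auto simp: power2_eq_square)
  next
    case 2
    thus ?thesis by (intro image_eqI[of _ _ "2 * i + 1"]) auto
  qed
qed

lemma outermost_products:
  fixes u :: "nat \<Rightarrow> 'a::times"
  assumes "m \<ge> 1"
  shows "(\<lambda>k. u (max 1 (k - m)) * u (min m (k - 1))) ` {2..2 * m} =
    {u 1 * u j | j. j \<in> {1..m}} \<union> {u i * u m | i. i \<in> {2..m}}" (is "?v ` _ = ?A \<union> ?B")
proof (intro equalityI subsetI)
  fix x assume "x \<in> ?v ` {2..2 * m}"
  then obtain k where k: "2 \<le> k" "k \<le> 2 * m" "x = ?v k" by auto
  show "x \<in> ?A \<union> ?B"
  proof (cases "k \<le> m + 1")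
    case True
    hence "max 1 (k - m) = 1" "min m (k - 1) = k - 1" "k - 1 \<in> {1..m}" using k by auto
    thus ?thesis unfolding k(3) by auto
  next
    case False
    hence "max 1 (k - m) = k - m" "min m (k - 1) = m" "k - m \<in> {2..m}" using k by auto
    thus ?thesis unfolding k(3) by auto
  qed
next
  fix x assume "x \<in> ?A \<union> ?B"
  then consider j where "j \<in> {1..m}" "x = u 1 * u j" | i where "i \<in> {2..m}" "x = u i * u m"
    by blast
  thus "x \<in> ?v ` {2..2 * m}"
  proof cases
    case 1
    hence "max 1 (j + 1 - m) = 1" "min m (j + 1 - 1) = j" by auto
    with 1 show ?thesis using assms by (intro image_eqI[of _ _ "j + 1"]) auto
  next
    case 2
    hence "max 1 (i + m - m) = i" "min m (i + m - 1) = m" by auto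
    with 2 show ?thesis by (intro image_eqI[of _ _ "i + m"]) auto
  qed
qed

theorem proposition4p2:
  fixes m :: nat and a b :: "nat \<Rightarrow> int"
    and u :: "nat \<Rightarrow> 'k::field poly2" and I :: "'k poly2 set"
  assumes "m \<ge> 2"
    and "strict_antimono_on {1..m} a" and "a m = 0"
    and "strict_mono_on {1..m} b" and "b 1 = 0"
    and "\<And>i. i \<in> {1..m} \<Longrightarrow> u i = mon (nat (a i)) (nat (b i))"
    and "monomial_ideal I" and "min_gens I = u ` {1..m}"
    and "(convex_seq m a \<and> convex_seq m b) \<or> (concave_seq m a \<and> concave_seq m b)"
  shows "(\<forall>k\<in>{2..2 * m}. \<exists>!v. v \<in> diagonal u m k \<and> v \<in> min_gens (ideal_mult I I)) \<and>
    mu (ideal_mult I I) = 2 * mu I - 1 \<and>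
    (concave_seq m a \<and> concave_seq m b \<longrightarrow>
      min_gens (ideal_mult I I) =
        {u i ^ 2 | i. i \<in> {1..m}} \<union> {u i * u (i + 1) | i. i \<in> {1..m - 1}}) \<and>
    (convex_seq m a \<and> convex_seq m b \<longrightarrow>
      min_gens (ideal_mult I I) =
        {u 1 * u j | j. j \<in> {1..m}} \<union> {u i * u m | i. i \<in> {2..m}})"
proof -
  define p where "p i = nat (a i)" for i
  define q where "q i = nat (b i)" for i
  have a_nonneg: "a i \<ge> 0" if "i \<in> {1..m}" for i
    using that monotone_onD[OF assms(2), of i m] assms(3) by (cases "i = m") auto
  have b_nonneg: "b i \<ge> 0" if "i \<in> {1..m}" for i
    using that monotone_onD[OF assms(4), of 1 i] assms(5) by (cases "i = 1") auto
  have u: "u i = mon (p i) (q i)" if "i \<in> {1..m}" for i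
    using assms(6)[OF that] by (simp add: p_def q_def)
  have p: "strict_antimono_on {1..m} p"
  proof (rule monotone_onI)
    fix i j assume "i \<in> {1..m}" "j \<in> {1..m}" "i < j"
    thus "p j < p i" using monotone_onD[OF assms(2), of i j] a_nonneg[of j] by (simp add: p_def)
  qed
  have q: "strict_mono_on {1..m} q"
  proof (rule monotone_onI)
    fix i j assume "i \<in> {1..m}" "j \<in> {1..m}" "i < j"
    thus "q i < q j" using monotone_onD[OF assms(4), of i j] b_nonneg[of i] by (simp add: q_def)
  qed
  have I: "I = ideal.span (u ` {1..m})"
    using span_min_gens[OF assms(7)] assms(8) by simp
  have "inj_on u {1..m}"
  proof (rule inj_onI)
    fix i j assume ij: "i \<in> {1..m}" "j \<in> {1..m}" "u i = u j"
    hence "q i = q j" by (simp add: u mon_eq_iff)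
    thus "i = j"
      using ij monotone_onD[OF q, of i j] monotone_onD[OF q, of j i]
      by (cases i j rule: linorder_cases) auto
  qed
  hence mu: "mu I = m"
    unfolding mu_def assms(8) by (simp add: card_image)
  have main: "min_gens (ideal_mult I I) = (\<lambda>k. u (s k) * u (t k)) ` {2..2 * m} \<and>
      mu (ideal_mult I I) = 2 * mu I - 1 \<and>
      (\<forall>k\<in>{2..2 * m}. \<exists>!v. v \<in> diagonal u m k \<and> v \<in> min_gens (ideal_mult I I))"
    if sel: "\<And>k. k \<in> {2..2 * m} \<Longrightarrow> 1 \<le> s k \<and> s k \<le> t k \<and> t k \<le> m \<and> s k + t k = k"
      and min: "\<And>c i j. c = a \<or> c = b \<Longrightarrow> i \<in> {1..m} \<Longrightarrow> j \<in> {1..m} \<Longrightarrow>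
        c (s (i + j)) + c (t (i + j)) \<le> c i + c j" for s t
  proof -
    have st: "s (i + j) \<in> {1..m}" "t (i + j) \<in> {1..m}" if "i \<in> {1..m}" "j \<in> {1..m}" for i j
      using that sel[of "i + j"] by auto
    have min_p: "p (s (i + j)) + p (t (i + j)) \<le> p i + p j" if "i \<in> {1..m}" "j \<in> {1..m}" for i j
      using min[of a, OF _ that] that st[OF that] a_nonneg by (simp add: p_def flip: nat_add_distrib)
    have min_q: "q (s (i + j)) + q (t (i + j)) \<le> q i + q j" if "i \<in> {1..m}" "j \<in> {1..m}" for i j
      using min[of b, OF _ that] that st[OF that] b_nonneg by (simp add: q_def flip: nat_add_distrib)
    note diag = min_gens_square_if_diagonal_minima[OF u p q sel min_p min_q, folded I]
    show ?thesis unfolding mu using diag by blast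
  qed
  let ?diagonals = "\<forall>k\<in>{2..2 * m}. \<exists>!v. v \<in> diagonal u m k \<and> v \<in> min_gens (ideal_mult I I)"
  let ?count = "mu (ideal_mult I I) = 2 * mu I - 1"
  have concave: "min_gens (ideal_mult I I) =
      {u i ^ 2 | i. i \<in> {1..m}} \<union> {u i * u (i + 1) | i. i \<in> {1..m - 1}} \<and> ?count \<and> ?diagonals"
    if c: "concave_seq m a \<and> concave_seq m b"
    unfolding innermost_products[symmetric]
  proof (rule main)
    fix k assume "k \<in> {2..2 * m}"
    thus "1 \<le> k div 2 \<and> k div 2 \<le> Suc k div 2 \<and> Suc k div 2 \<le> m \<and> k div 2 + Suc k div 2 = k"
      by auto
  next
    fix e :: "nat \<Rightarrow> int" and i j
    assume "e = a \<or> e = b" and ij: "i \<in> {1..m}" "j \<in> {1..m}"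
    with c have "concave_seq m e" by auto
    from concave_seq_innermost[OF this ij]
    show "e ((i + j) div 2) + e (Suc (i + j) div 2) \<le> e i + e j" .
  qed
  have convex: "min_gens (ideal_mult I I) =
      {u 1 * u j | j. j \<in> {1..m}} \<union> {u i * u m | i. i \<in> {2..m}} \<and> ?count \<and> ?diagonals"
    if c: "convex_seq m a \<and> convex_seq m b"
    unfolding outermost_products[OF order_trans[OF one_le_numeral assms(1)], symmetric]
  proof (rule main)
    fix k assume "k \<in> {2..2 * m}"
    thus "1 \<le> max 1 (k - m) \<and> max 1 (k - m) \<le> min m (k - 1) \<and> min m (k - 1) \<le> m \<and>
        max 1 (k - m) + min m (k - 1) = k"
      by (auto simp: max_def min_def)
  next
    fix e :: "nat \<Rightarrow> int" and i j
    assume "e = a \<or> e = b" and ij: "i \<in> {1..m}" "j \<in> {1..m}"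
    with c have "convex_seq m e" by auto
    from convex_seq_outermost[OF this ij]
    show "e (max 1 (i + j - m)) + e (min m (i + j - 1)) \<le> e i + e j" .
  qed
  have both: "?count \<and> ?diagonals"
    using assms(9) conjunct2[OF convex] conjunct2[OF concave] by (rule disjE)
  show ?thesis
    by (intro conjI impI conjunct2[OF both] conjunct1[OF both];
        erule conjunct1[OF concave] conjunct1[OF convex])
qed

end
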